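(* Let $\{(\mathbf{x}_i,y_i)\}_{i=1}^n$ be independent observations from the $k$-sample linear regression model described in the context. Suppose that for every $1\le j\le k$ the sample size $n_j$ is divisible by the window size $n_0$, and that the predictor $\mathbf{x}$, the intercept $\nu$ and the error $\varepsilon$ are mutually independent. Then the EM estimator $\hat{\bm{\beta}}_{\mathrm{EM}}$ is unbiased for $\bm{\beta}$, i.e. $$\mathbb{E}[\hat{\bm{\beta}}_{\mathrm{EM}}]=\bm{\beta}.$$
   Context: Model. The observations satisfy $y_i=\mathbf{x}_i^{\top}\bm{\beta}+\nu_i+\varepsilon_i$, $i=1,\dots,n$, with $\bm{\beta}\in\mathbb{R}^p$ the vector of regression coefficients, $\mathbf{x}_i\in\mathbb{R}^p$ predictors having a certain distribution $F_{\mathbf{x}}$, $\nu_i$ a random intercept and $\varepsilon_i$ an error; the pairs $(\mathbf{x}_i,y_i)$ are independent across $i$. The data consist of $k$ consecutive samples (groups), the $j$th of size $n_j$, with $\sum_{j=1}^k n_j=n$. For every index $i$ in the $j$th sample, $\nu_i$ follows the one-point distribution at $c_j$, where $c_j\in[\underline{\mu},\overline{\mu}]$ with $\underline{\mu}=\min_{1\le j\le k} c_j$ and $\overline{\mu}=\max_{1\le j\le k} c_j$, and $\varepsilon_i\sim\mathcal{N}(0,\sigma_j^2)$ with $\sigma_j\in[\underline{\sigma},\overline{\sigma}]$, $0<\underline{\sigma}\le\overline{\sigma}<\infty$. The number of samples and the locations of the change points between them are not known. $\mathbb{E}$ denotes classical expectation with respect to the actual distribution. Windows. $n_0$ is a positive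 integer (small window size) with $n_0<\min_{1\le j\le k} n_j$, and $T=n/n_0$. The $j$th window is the index set $\{1+(j-1)n_0,\dots,jn_0\}$, $1\le j\le T$. Divisibility of each $n_j$ by $n_0$ ensures that each window lies within a single sample. EM estimator. Starting from an initial $\bm{\beta}^{(0)}$, the algorithm alternates: (E-step) given $\bm{\beta}^{(s)}$, set $a_j=\frac1{n_0}\sum_{i=1+(j-1)n_0}^{jn_0}(y_i-\mathbf{x}_i^{\top}\bm{\beta}^{(s)})$ and $\nu_i^{(s+1)}=a_j$ for all $i$ in window $j$, $1\le j\le T$; (M-step) let $\bm{\beta}^{(s+1)}$ minimize $\sum_{i=1}^n\{y_i-(\mathbf{x}_i^{\top}\bm{\beta}+\nu_i^{(s+1)})\}^2$ over $\bm{\beta}$, i.e. solve $\sum_{i=1}^n\{y_i-(\mathbf{x}_i^{\top}\bm{\beta}^{(s+1)}+\nu_i^{(s+1)})\}\mathbf{x}_i=\mathbf{0}$. The EM estimator $\hat{\bm{\beta}}_{\mathrm{EM}}$ is the value upon convergence, which together with numbers $\hat a_1,\dots,\hat a_T$ satisfies both $$\sum_{i=1+(j-1)n_0}^{jn_0}(y_i-\hat a_j-\mathbf{x}_i^{\top}\hat{\bm{\beta}}_{\mathrm{EM}})=0\ (1\le j\le T),\qquad \sum_{j=1}^T\sum_{i=1+(j-1)n_0}^{jn_0}(y_i-\hat a_j-\mathbf{x}_i^{\top}\hat{\bm{\beta}}_{\mathrm{EM}})\mathbf{x}_i=\mathbf{0}.$$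
   Formalization: Two conditions are added: almost surely the two displayed estimating equations determine the EM estimator uniquely (this fails for n_0 = 1, where EM stays at its starting value), and the expectation of the EM estimator exists (it can fail to, even for Gaussian predictors). *)

theory Defs
  imports "HOL-Probability.Probability"
begin

text \<open>
  All observations, samples and windows are numbered from 1, and predictors are vectors
  \<^typ>\<open>real ^ 'p\<close>, so that \<open>p = CARD('p)\<close> is arbitrary.
\<close>

definition sample_indices :: "(nat \<Rightarrow> nat) \<Rightarrow> nat \<Rightarrow> nat set" where
  "sample_indices ns j = {1 + (\<Sum>l = 1..<j. ns l)..(\<Sum>l = 1..j. ns l)}"

text \<open>
  The index argument of \<^const>\<open>prob_space.indep_vars\<close> forces all variables to share one value type.
  A vector and two scalars are therefore handled through the sigma-algebras they generate.
\<close>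

definition (in prob_space) mutually_indep3 ::
  "('a \<Rightarrow> 'b :: topological_space) \<Rightarrow> ('a \<Rightarrow> 'c :: topological_space) \<Rightarrow>
   ('a \<Rightarrow> 'd :: topological_space) \<Rightarrow> bool" where
  "mutually_indep3 X Y Z \<longleftrightarrow>
     random_variable borel X \<and> random_variable borel Y \<and> random_variable borel Z \<and>
     indep_sets (\<lambda>r. [{X -` A \<inter> space M | A. A \<in> sets borel},
                      {Y -` A \<inter> space M | A. A \<in> sets borel},
                      {Z -` A \<inter> space M | A. A \<in> sets borel}] ! r) {0, 1, 2 :: nat}"

locale k_sample_model = prob_space M
  for M :: "'a measure"
    and k :: nat and ns :: "nat \<Rightarrow> nat" and n :: nat
    and \<beta> :: "real ^ 'p"
    and x :: "nat \<Rightarrow> 'a \<Rightarrow> real ^ 'p" and y \<nu> \<epsilon> :: "nat \<Rightarrow> 'a \<Rightarrow> real"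
    and F :: "(real ^ 'p) measure"
    and c \<sigma> :: "nat \<Rightarrow> real"
    and \<mu>_lo \<mu>_hi \<sigma>_lo \<sigma>_hi :: real +
  assumes k_pos: "1 \<le> k"
    and n_eq: "n = (\<Sum>j = 1..k. ns j)"
    and x_measurable: "i \<in> {1..n} \<Longrightarrow> random_variable borel (x i)"
    and \<nu>_measurable: "i \<in> {1..n} \<Longrightarrow> random_variable borel (\<nu> i)"
    and model: "i \<in> {1..n} \<Longrightarrow> \<omega> \<in> space M \<Longrightarrow> y i \<omega> = x i \<omega> \<bullet> \<beta> + \<nu> i \<omega> + \<epsilon> i \<omega>"
    and x_distr: "i \<in> {1..n} \<Longrightarrow> distr M borel (x i) = F"
    and pairs_indep: "indep_vars (\<lambda>_. borel) (\<lambda>i \<omega>. (x i \<omega>, y i \<omega>)) {1..n}"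
    and \<mu>_lo_eq: "\<mu>_lo = Min (c ` {1..k})"
    and \<mu>_hi_eq: "\<mu>_hi = Max (c ` {1..k})"
    and c_bounds: "j \<in> {1..k} \<Longrightarrow> c j \<in> {\<mu>_lo..\<mu>_hi}"
    and \<nu>_distr: "j \<in> {1..k} \<Longrightarrow> i \<in> sample_indices ns j \<Longrightarrow> distr M borel (\<nu> i) = return borel (c j)"
    and \<sigma>_lo_pos: "0 < \<sigma>_lo"
    and \<sigma>_lo_le_hi: "\<sigma>_lo \<le> \<sigma>_hi"
    and \<sigma>_bounds: "j \<in> {1..k} \<Longrightarrow> \<sigma> j \<in> {\<sigma>_lo..\<sigma>_hi}"
    and \<epsilon>_distr: "j \<in> {1..k} \<Longrightarrow> i \<in> sample_indices ns j \<Longrightarrow>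
                   distributed M lborel (\<epsilon> i) (\<lambda>t. ennreal (normal_density 0 (\<sigma> j) t))"

definition window :: "nat \<Rightarrow> nat \<Rightarrow> nat set" where
  "window n0 j = {1 + (j - 1) * n0..j * n0}"

text \<open>
  In the following, \<open>x\<close> and \<open>y\<close> are the data of one realization. The number of windows \<open>T\<close> is
  \<open>n div n0\<close>; the division is exact whenever \<open>n0\<close> divides every sample size. An index \<open>i \<ge> 1\<close> lies
  in the window with number \<open>(i - 1) div n0 + 1\<close>.
\<close>

definition window_intercept ::
  "nat \<Rightarrow> (nat \<Rightarrow> real ^ 'p) \<Rightarrow> (nat \<Rightarrow> real) \<Rightarrow> real ^ 'p \<Rightarrow> nat \<Rightarrow> real" where
  "window_intercept n0 x y b j = (1 / real n0) * (\<Sum>i \<in> window n0 j. y i - x i \<bullet> b)"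

definition E_step ::
  "nat \<Rightarrow> (nat \<Rightarrow> real ^ 'p) \<Rightarrow> (nat \<Rightarrow> real) \<Rightarrow> real ^ 'p \<Rightarrow> nat \<Rightarrow> real" where
  "E_step n0 x y b i = window_intercept n0 x y b ((i - 1) div n0 + 1)"

definition M_step ::
  "nat \<Rightarrow> (nat \<Rightarrow> real ^ 'p) \<Rightarrow> (nat \<Rightarrow> real) \<Rightarrow> (nat \<Rightarrow> real) \<Rightarrow> real ^ 'p \<Rightarrow> bool" where
  "M_step n x y v b \<longleftrightarrow> is_arg_min (\<lambda>b'. \<Sum>i = 1..n. (y i - (x i \<bullet> b' + v i))\<^sup>2) (\<lambda>_. True) b"

text \<open>The starting value \<open>b 0\<close> is arbitrary.\<close>

definition EM_run ::
  "nat \<Rightarrow> nat \<Rightarrow> (nat \<Rightarrow> real ^ 'p) \<Rightarrow> (nat \<Rightarrow> real) \<Rightarrow> (nat \<Rightarrow> real ^ 'p) \<Rightarrow> bool" where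
  "EM_run n n0 x y b \<longleftrightarrow> (\<forall>s. M_step n x y (E_step n0 x y (b s)) (b (Suc s)))"

definition EM_estimator ::
  "nat \<Rightarrow> nat \<Rightarrow> (nat \<Rightarrow> real ^ 'p) \<Rightarrow> (nat \<Rightarrow> real) \<Rightarrow> real ^ 'p \<Rightarrow> bool" where
  "EM_estimator n n0 x y bhat \<longleftrightarrow> (\<exists>b. EM_run n n0 x y b \<and> b \<longlonglongrightarrow> bhat)"

definition EM_equations ::
  "nat \<Rightarrow> nat \<Rightarrow> (nat \<Rightarrow> real ^ 'p) \<Rightarrow> (nat \<Rightarrow> real) \<Rightarrow> (nat \<Rightarrow> real) \<Rightarrow> real ^ 'p \<Rightarrow> bool" where
  "EM_equations n n0 x y a b \<longleftrightarrow>
     (\<forall>j \<in> {1..n div n0}. (\<Sum>i \<in> window n0 j. y i - a j - x i \<bullet> b) = 0) \<and>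
     (\<Sum>j = 1..n div n0. \<Sum>i \<in> window n0 j. (y i - a j - x i \<bullet> b) *\<^sub>R x i) = 0"

text \<open>
  Identification: the data determine the regression coefficients in the EM equations.
  Equivalently, the within-window scatter matrix of the predictors is nonsingular. Without it every
  point of a nontrivial affine subspace is a fixed point of the iteration, and the limit depends on
  the starting value; this is always the case for \<open>n0 = 1\<close>.
\<close>

definition EM_identified ::
  "nat \<Rightarrow> nat \<Rightarrow> (nat \<Rightarrow> real ^ 'p) \<Rightarrow> (nat \<Rightarrow> real) \<Rightarrow> bool" where
  "EM_identified n n0 x y \<longleftrightarrow> (\<exists>!b. \<exists>a. EM_equations n n0 x y a b)"

end

theory Submission
  imports Defs
begin

text \<open>
  Unbiasedness comes from a symmetry, not from a conditional expectation. Eliminating the window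
  intercepts from the EM equations leaves the normal equations of least squares on the data centred
  within windows, \<open>S *v b = u(y)\<close>, where the matrix \<open>S\<close> depends on the predictors only and the vector
  \<open>u(y)\<close> is linear in the responses (\<open>EM_equations_iff_within_cross\<close>, \<open>within_scatter_vector_mult\<close>).
  Each window lies inside one sample, so centring removes the intercepts from
  \<open>y i = x i \<bullet> \<beta> + \<nu> i + \<epsilon> i\<close>, and \<open>S *v (bhat - \<beta>) = u(\<epsilon>)\<close>. Identification makes \<open>S\<close> nonsingular.
  Hence the estimation error is a fixed function of predictors and errors that is odd in the errors
  (\<open>EM_estimator_error\<close>, \<open>within_ols_uminus\<close>).

  The law of a pair \<open>(x i, \<epsilon> i)\<close> is a product with a centred normal second factor, hence invariant
  under a change of sign of the error. The pairs are independent across \<open>i\<close>, so their joint law is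
  invariant when all signs change at once. An odd function therefore has the same expectation as its
  negative, which makes it 0 (\<open>expectation_odd_eq_0\<close>). Cramer's rule writes the error as an explicit
  quotient of determinants, which gives its measurability.

  The independence hypotheses are about the pairs \<open>(x i, y i)\<close> across \<open>i\<close> and about
  \<open>x i\<close>, \<open>\<nu> i\<close>, \<open>\<epsilon> i\<close> for a single \<open>i\<close>. They combine because \<open>\<nu> i\<close> is almost surely constant:
  the error is then almost surely a function of the pair \<open>(x i, y i)\<close>.
\<close>

section \<open>Least squares after centring within windows\<close>

definition window_centred :: "nat \<Rightarrow> (nat \<Rightarrow> 'v::real_vector) \<Rightarrow> nat \<Rightarrow> nat \<Rightarrow> 'v" where
  "window_centred n0 f j i = f i - (1 / real n0) *\<^sub>R (\<Sum>l \<in> window n0 j. f l)"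

definition within_cross ::
  "nat \<Rightarrow> nat \<Rightarrow> (nat \<Rightarrow> real ^ 'p) \<Rightarrow> (nat \<Rightarrow> real) \<Rightarrow> real ^ 'p" where
  "within_cross n n0 x z = (\<Sum>j = 1..n div n0. \<Sum>i \<in> window n0 j. window_centred n0 z j i *\<^sub>R x i)"

definition within_scatter :: "nat \<Rightarrow> nat \<Rightarrow> (nat \<Rightarrow> real ^ 'p) \<Rightarrow> real ^ 'p ^ 'p" where
  "within_scatter n n0 x =
     (\<chi> r s. \<Sum>j = 1..n div n0. \<Sum>i \<in> window n0 j. x i $ r * window_centred n0 x j i $ s)"

text \<open>
  The total formula of Cramer's rule, in place of an inverse matrix, makes measurability in \<open>A\<close> and \<open>u\<close>
  a matter of sums and products. Its value is 0 when \<open>A\<close> is singular.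
\<close>

definition cramer_solution :: "real ^ 'p ^ 'p \<Rightarrow> real ^ 'p \<Rightarrow> real ^ 'p" where
  "cramer_solution A u = (\<chi> k. det (\<chi> i j. if j = k then u $ i else A $ i $ j) / det A)"

lemma window_subset:
  assumes "j \<in> {1..n div n0}"
  shows "window n0 j \<subseteq> {1..n}"
proof -
  have "j * n0 \<le> n div n0 * n0" using assms by (intro mult_right_mono) auto
  also have "\<dots> \<le> n" by simp
  finally show ?thesis by (auto simp: window_def)
qed

lemma card_window: "1 \<le> j \<Longrightarrow> card (window n0 j) = n0"
  by (cases j) (auto simp: window_def)

lemma window_number:
  assumes "0 < n0" "1 \<le> j" "i \<in> window n0 j"
  shows "(i - 1) div n0 + 1 = j"
proof -
  obtain m where j: "j = Suc m" using assms(2) by (cases j) auto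
  have "(i - 1) div n0 = m"
    using assms unfolding j window_def by (intro div_nat_eqI) (auto simp: algebra_simps)
  then show ?thesis using j by simp
qed

lemma sum_windows:
  fixes f :: "nat \<Rightarrow> 'v::comm_monoid_add"
  assumes "n0 dvd n" "0 < n0"
  shows "(\<Sum>j = 1..n div n0. \<Sum>i \<in> window n0 j. f i) = (\<Sum>i = 1..n. f i)"
proof -
  have "(\<Sum>j = 1..T. \<Sum>i \<in> window n0 j. f i) = (\<Sum>i = 1..T * n0. f i)" for T
  proof (induction T)
    case (Suc T)
    have "{1..Suc T * n0} = {1..T * n0} \<union> window n0 (Suc T)"
         "{1..T * n0} \<inter> window n0 (Suc T) = {}"
      by (auto simp: window_def)
    moreover have "finite (window n0 (Suc T))" by (simp add: window_def)
    ultimately have "(\<Sum>i = 1..Suc T * n0. f i)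
        = (\<Sum>i = 1..T * n0. f i) + (\<Sum>i \<in> window n0 (Suc T). f i)"
      using sum.union_disjoint[of "{1..T * n0}" "window n0 (Suc T)" f] by (metis finite_atLeastAtMost)
    then show ?case using Suc by simp
  qed simp
  from this[of "n div n0"] show ?thesis using assms by simp
qed

lemma window_centred_diff:
  "window_centred n0 (\<lambda>i. f i - g i) j i = window_centred n0 f j i - window_centred n0 g j i"
  by (simp add: window_centred_def sum_subtractf algebra_simps)

lemma within_cross_diff:
  "within_cross n n0 x (\<lambda>i. z i - w i) = within_cross n n0 x z - within_cross n n0 x w"
  by (simp add: within_cross_def window_centred_diff scaleR_left_diff_distrib sum_subtractf)

lemma within_cross_uminus:
  "within_cross n n0 x (\<lambda>i. - z i) = - within_cross n n0 x z"
  using within_cross_diff[of n n0 x "\<lambda>_. 0" z] by (simp add: within_cross_def window_centred_def)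

lemma within_cross_cong:
  assumes "\<And>i. i \<in> {1..n} \<Longrightarrow> x i = x' i" "\<And>i. i \<in> {1..n} \<Longrightarrow> z i = z' i"
  shows "within_cross n n0 x z = within_cross n n0 x' z'"
  unfolding within_cross_def window_centred_def
  using assms window_subset[of _ n n0]
  by (intro sum.cong arg_cong2[where f = scaleR] arg_cong2[where f = minus] refl) (auto simp: subset_iff)

lemma within_scatter_cong:
  assumes "\<And>i. i \<in> {1..n} \<Longrightarrow> x i = x' i"
  shows "within_scatter n n0 x = within_scatter n n0 x'"
proof -
  have "window_centred n0 x j i = window_centred n0 x' j i"
    if "j \<in> {1..n div n0}" "i \<in> window n0 j" for j i
    unfolding window_centred_def using assms window_subset[OF that(1)] that(2)
    by (intro arg_cong2[where f = minus] arg_cong2[where f = scaleR] sum.cong) auto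
  moreover have "x i = x' i" if "j \<in> {1..n div n0}" "i \<in> window n0 j" for j i
    using assms window_subset[OF that(1)] that(2) by auto
  ultimately show ?thesis
    unfolding within_scatter_def by (simp add: vec_eq_iff)
qed

text \<open>
  This is how the unknown intercepts disappear: they agree with their window means.
\<close>

lemma within_cross_window_constant:
  assumes "\<And>j i. j \<in> {1..n div n0} \<Longrightarrow> i \<in> window n0 j \<Longrightarrow> z i = a j" "0 < n0"
  shows "within_cross n n0 x z = 0"
proof -
  have "window_centred n0 z j i = 0" if j: "j \<in> {1..n div n0}" and i: "i \<in> window n0 j" for j i
  proof -
    have "(\<Sum>l \<in> window n0 j. z l) = (\<Sum>l \<in> window n0 j. a j)"
      using assms(1)[OF j] by (intro sum.cong) auto
    then show ?thesis using assms(1)[OF j i] j assms(2)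
      by (simp add: window_centred_def card_window)
  qed
  then show ?thesis by (simp add: within_cross_def)
qed

text \<open>
  Fitted values \<open>x i \<bullet> b\<close> enter the centred normal equations as responses do. Hence
  \<open>within_cross\<close> applied to the residuals is \<open>u(y) - S *v b\<close>, and uniqueness of the solution is
  nonsingularity of \<open>S\<close>.
\<close>

lemma within_scatter_vector_mult:
  "within_scatter n n0 x *v b = within_cross n n0 x (\<lambda>i. x i \<bullet> b)"
proof -
  have centred: "window_centred n0 (\<lambda>i. x i \<bullet> b) j i = window_centred n0 x j i \<bullet> b" for j i
    by (simp add: window_centred_def inner_diff_left inner_sum_left)
  have "(within_scatter n n0 x *v b) $ r = within_cross n n0 x (\<lambda>i. x i \<bullet> b) $ r" for r
  proof -
    have "(within_scatter n n0 x *v b) $ r =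
        (\<Sum>s\<in>UNIV. \<Sum>j = 1..n div n0. \<Sum>i \<in> window n0 j. x i $ r * window_centred n0 x j i $ s * b $ s)"
      by (simp add: matrix_vector_mult_def within_scatter_def sum_distrib_right)
    also have "\<dots> = (\<Sum>j = 1..n div n0. \<Sum>s\<in>UNIV. \<Sum>i \<in> window n0 j. x i $ r * window_centred n0 x j i $ s * b $ s)"
      by (rule sum.swap)
    also have "\<dots> = (\<Sum>j = 1..n div n0. \<Sum>i \<in> window n0 j. \<Sum>s\<in>UNIV. x i $ r * window_centred n0 x j i $ s * b $ s)"
      by (intro sum.cong refl sum.swap)
    also have "\<dots> = within_cross n n0 x (\<lambda>i. x i \<bullet> b) $ r"
      unfolding within_cross_def centred by (simp add: inner_vec_def sum_distrib_left mult_ac)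
    finally show ?thesis .
  qed
  then show ?thesis by (simp add: vec_eq_iff)
qed

text \<open>
  The first family of EM equations forces each intercept to be the window mean of the residuals;
  substituting these means turns the residuals in the second equation into centred ones.
\<close>

lemma EM_equations_iff_within_cross:
  assumes "0 < n0"
  shows "(\<exists>a. EM_equations n n0 x y a b) \<longleftrightarrow> within_cross n n0 x (\<lambda>i. y i - x i \<bullet> b) = 0"
proof -
  define m where "m j = (1 / real n0) * (\<Sum>i \<in> window n0 j. y i - x i \<bullet> b)" for j
  have mean: "(\<Sum>i \<in> window n0 j. y i - a j - x i \<bullet> b) = 0 \<longleftrightarrow> a j = m j"
    if "j \<in> {1..n div n0}" for a j
  proof -
    have "(\<Sum>i \<in> window n0 j. y i - a j - x i \<bullet> b)
        = (\<Sum>i \<in> window n0 j. y i - x i \<bullet> b) - real n0 * a j"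
      using that by (simp add: sum_subtractf card_window)
    then show ?thesis using assms by (auto simp: m_def field_simps)
  qed
  have cross: "(\<Sum>j = 1..n div n0. \<Sum>i \<in> window n0 j. (y i - a j - x i \<bullet> b) *\<^sub>R x i)
      = within_cross n n0 x (\<lambda>i. y i - x i \<bullet> b)"
    if "\<forall>j \<in> {1..n div n0}. a j = m j" for a
    unfolding within_cross_def window_centred_def using that
    by (intro sum.cong refl arg_cong2[where f = scaleR]) (auto simp: m_def)
  show ?thesis
  proof
    assume "\<exists>a. EM_equations n n0 x y a b"
    then obtain a where "EM_equations n n0 x y a b" ..
    then have "\<forall>j \<in> {1..n div n0}. a j = m j"
      and "(\<Sum>j = 1..n div n0. \<Sum>i \<in> window n0 j. (y i - a j - x i \<bullet> b) *\<^sub>R x i) = 0"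
      unfolding EM_equations_def using mean by blast+
    then show "within_cross n n0 x (\<lambda>i. y i - x i \<bullet> b) = 0"
      using cross[of a] by simp
  next
    assume "within_cross n n0 x (\<lambda>i. y i - x i \<bullet> b) = 0"
    then have "EM_equations n n0 x y m b"
      using mean[of _ m] cross[of m] by (simp add: EM_equations_def)
    then show "\<exists>a. EM_equations n n0 x y a b" by blast
  qed
qed

text \<open>
  Adding a kernel vector of \<open>S\<close> to one solution gives another solution.
\<close>

lemma EM_identified_imp_det_nonzero:
  assumes "0 < n0" "EM_identified n n0 x y"
  shows "det (within_scatter n n0 x) \<noteq> 0"
proof -
  let ?S = "within_scatter n n0 x"
  have ex1: "\<exists>!b. within_cross n n0 x (\<lambda>i. y i - x i \<bullet> b) = 0"
    using assms unfolding EM_identified_def EM_equations_iff_within_cross[OF assms(1)] by simp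
  have eq: "within_cross n n0 x (\<lambda>i. y i - x i \<bullet> b) = within_cross n n0 x y - ?S *v b" for b
    by (simp add: within_cross_diff within_scatter_vector_mult)
  from ex1 obtain b where b: "within_cross n n0 x (\<lambda>i. y i - x i \<bullet> b) = 0" by blast
  have "v = 0" if "?S *v v = 0" for v
  proof -
    have "within_cross n n0 x (\<lambda>i. y i - x i \<bullet> (b + v)) = 0"
      using b that by (simp add: eq matrix_vector_right_distrib)
    then have "b + v = b" using ex1 b by blast
    then show ?thesis by simp
  qed
  then have "\<exists>B. B ** ?S = mat 1" by (simp add: matrix_left_invertible_ker)
  then show ?thesis
    using invertible_det_nz invertible_left_inverse by blast
qed

section \<open>Limits of the iteration\<close>

text \<open>
  Let \<open>g\<close> be the left-hand side, a multiple of the gradient. Along \<open>g\<close> the objective is a quadratic polynomial in the step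
  length \<open>t\<close> with linear coefficient \<open>- 2 * (g \<bullet> g)\<close>, so a small positive step would decrease it
  unless \<open>g = 0\<close>.
\<close>

lemma least_squares_normal_equations:
  fixes x :: "nat \<Rightarrow> 'v::real_inner"
  assumes min: "\<And>b'. (\<Sum>i\<in>I. (r i - x i \<bullet> b)\<^sup>2) \<le> (\<Sum>i\<in>I. (r i - x i \<bullet> b')\<^sup>2)"
  shows "(\<Sum>i\<in>I. (r i - x i \<bullet> b) *\<^sub>R x i) = 0"
proof -
  define g where "g = (\<Sum>i\<in>I. (r i - x i \<bullet> b) *\<^sub>R x i)"
  define K where "K = (\<Sum>i\<in>I. (x i \<bullet> g)\<^sup>2)"
  have K: "0 \<le> K" by (simp add: K_def sum_nonneg)
  have expand: "(\<Sum>i\<in>I. (r i - x i \<bullet> (b + t *\<^sub>R g))\<^sup>2)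
      = (\<Sum>i\<in>I. (r i - x i \<bullet> b)\<^sup>2) - 2 * t * (g \<bullet> g) + t\<^sup>2 * K" for t
  proof -
    have "(\<Sum>i\<in>I. (r i - x i \<bullet> (b + t *\<^sub>R g))\<^sup>2)
        = (\<Sum>i\<in>I. (r i - x i \<bullet> b)\<^sup>2 - 2 * t * ((r i - x i \<bullet> b) * (x i \<bullet> g)) + t\<^sup>2 * (x i \<bullet> g)\<^sup>2)"
      by (intro sum.cong refl) (simp add: inner_add_right power2_eq_square algebra_simps)
    also have "\<dots> = (\<Sum>i\<in>I. (r i - x i \<bullet> b)\<^sup>2)
        - 2 * t * (\<Sum>i\<in>I. (r i - x i \<bullet> b) * (x i \<bullet> g)) + t\<^sup>2 * K"
      by (simp add: K_def sum.distrib sum_subtractf sum_distrib_left)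
    also have "(\<Sum>i\<in>I. (r i - x i \<bullet> b) * (x i \<bullet> g)) = g \<bullet> g"
      by (subst (2) g_def) (simp add: inner_sum_left)
    finally show ?thesis .
  qed
  \<comment> \<open>The minimizing step would be \<open>(g \<bullet> g) / K\<close>; the summand 1 covers the case \<open>K = 0\<close>.\<close>
  define t where "t = (g \<bullet> g) / (K + 1)"
  have "2 * t * (g \<bullet> g) \<le> t\<^sup>2 * K" using min[of "b + t *\<^sub>R g"] unfolding expand by simp
  moreover have gg: "g \<bullet> g = t * (K + 1)" using K by (simp add: t_def)
  ultimately have "t\<^sup>2 * (K + 2) \<le> 0" unfolding gg by (simp add: power2_eq_square algebra_simps)
  then have "t\<^sup>2 \<le> 0" using K by (simp add: mult_le_0_iff)
  then have "g \<bullet> g = 0" using gg by simp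
  then show ?thesis by (simp add: g_def)
qed

text \<open>
  Each M-step satisfies normal equations that depend continuously on two consecutive iterates, so the
  limit satisfies them with its own E-step intercepts, the window means of its residuals.
\<close>

lemma EM_estimator_within_cross:
  fixes x :: "nat \<Rightarrow> real ^ 'p"
  assumes "0 < n0" "n0 dvd n" "EM_estimator n n0 x y bhat"
  shows "within_cross n n0 x (\<lambda>i. y i - x i \<bullet> bhat) = 0"
proof -
  from assms(3) obtain b where run: "EM_run n n0 x y b" and lim: "b \<longlonglongrightarrow> bhat"
    unfolding EM_estimator_def by blast
  have step: "(\<Sum>i = 1..n. (y i - E_step n0 x y (b s) i - x i \<bullet> b (Suc s)) *\<^sub>R x i) = 0" for s
  proof (rule least_squares_normal_equations)
    fix b'
    have "(\<Sum>i = 1..n. (y i - (x i \<bullet> b (Suc s) + E_step n0 x y (b s) i))\<^sup>2)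
        \<le> (\<Sum>i = 1..n. (y i - (x i \<bullet> b' + E_step n0 x y (b s) i))\<^sup>2)"
      using run unfolding EM_run_def M_step_def is_arg_min_linorder by blast
    then show "(\<Sum>i = 1..n. (y i - E_step n0 x y (b s) i - x i \<bullet> b (Suc s))\<^sup>2)
        \<le> (\<Sum>i = 1..n. (y i - E_step n0 x y (b s) i - x i \<bullet> b')\<^sup>2)"
      by (simp add: algebra_simps)
  qed
  have lim': "(\<lambda>s. b (Suc s)) \<longlonglongrightarrow> bhat" using lim by (rule LIMSEQ_Suc)
  have "(\<lambda>s. \<Sum>i = 1..n. (y i - E_step n0 x y (b s) i - x i \<bullet> b (Suc s)) *\<^sub>R x i)
      \<longlonglongrightarrow> (\<Sum>i = 1..n. (y i - E_step n0 x y bhat i - x i \<bullet> bhat) *\<^sub>R x i)"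
    unfolding E_step_def window_intercept_def by (intro tendsto_intros lim lim')
  then have "(\<Sum>i = 1..n. (y i - E_step n0 x y bhat i - x i \<bullet> bhat) *\<^sub>R x i) = 0"
    unfolding step by (simp add: LIMSEQ_const_iff)
  then have "0 = (\<Sum>j = 1..n div n0. \<Sum>i \<in> window n0 j. (y i - E_step n0 x y bhat i - x i \<bullet> bhat) *\<^sub>R x i)"
    using sum_windows[OF assms(2,1), of "\<lambda>i. (y i - E_step n0 x y bhat i - x i \<bullet> bhat) *\<^sub>R x i"] by simp
  also have "\<dots> = within_cross n n0 x (\<lambda>i. y i - x i \<bullet> bhat)"
    unfolding within_cross_def
  proof (intro sum.cong refl arg_cong2[where f = scaleR])
    fix j i assume j: "j \<in> {1..n div n0}" and i: "i \<in> window n0 j"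
    have "E_step n0 x y bhat i = window_intercept n0 x y bhat j"
      using window_number[OF assms(1) _ i] j by (simp add: E_step_def)
    then show "y i - E_step n0 x y bhat i - x i \<bullet> bhat = window_centred n0 (\<lambda>i. y i - x i \<bullet> bhat) j i"
      by (simp add: window_centred_def window_intercept_def)
  qed
  finally show ?thesis by simp
qed

section \<open>The estimation error as a function of predictors and errors\<close>

lemma cramer_solution_unique:
  assumes "det A \<noteq> 0" "A *v b = u"
  shows "b = cramer_solution A u"
  using cramer[OF assms(1)] assms(2) unfolding cramer_solution_def by blast

text \<open>
  For singular \<open>A\<close> both sides are 0, because division by a zero determinant gives 0. So oddness
  holds everywhere, not only almost everywhere.
\<close>

lemma cramer_solution_uminus: "cramer_solution A (- u) = - cramer_solution A u"
proof (cases "det A = 0")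
  case True
  then show ?thesis by (simp add: cramer_solution_def vec_eq_iff)
next
  case False
  have "A *v cramer_solution A u = u"
    using cramer[OF False] unfolding cramer_solution_def by blast
  then have "A *v (- cramer_solution A u) = - u"
    by (metis matrix_vector_mult_diff_distrib matrix_vector_mult_0_right diff_0)
  from cramer_solution_unique[OF False this] show ?thesis by simp
qed

lemma borel_measurable_vec_iff:
  fixes f :: "'a \<Rightarrow> real ^ 'p"
  shows "f \<in> borel_measurable M \<longleftrightarrow> (\<forall>r. (\<lambda>w. f w $ r) \<in> borel_measurable M)"
  by (subst borel_measurable_euclidean_space) (auto simp: Basis_vec_def inner_axis)

lemma borel_measurable_det:
  fixes A :: "'a \<Rightarrow> real ^ 'p ^ 'p"
  assumes "\<And>r s. (\<lambda>w. A w $ r $ s) \<in> borel_measurable M"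
  shows "(\<lambda>w. det (A w)) \<in> borel_measurable M"
  unfolding det_def using assms by (intro borel_measurable_sum borel_measurable_times borel_measurable_prod) auto

lemma borel_measurable_cramer_solution:
  fixes A :: "'a \<Rightarrow> real ^ 'p ^ 'p"
  assumes "\<And>r s. (\<lambda>w. A w $ r $ s) \<in> borel_measurable M" "u \<in> borel_measurable M"
  shows "(\<lambda>w. cramer_solution (A w) (u w)) \<in> borel_measurable M"
proof -
  have u: "(\<lambda>w. u w $ r) \<in> borel_measurable M" for r
    using assms(2) borel_measurable_vec_iff[of u] by blast
  have "(\<lambda>w. if j = k then u w $ i else A w $ i $ j) \<in> borel_measurable M" for i j k
    using assms(1) u by (cases "j = k") auto
  then show ?thesis
    unfolding borel_measurable_vec_iff cramer_solution_def
    using assms(1) by (auto intro!: borel_measurable_divide borel_measurable_det)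
qed

text \<open>
  The coefficients of the regression of \<open>z\<close> on \<open>x\<close> after centring both within windows (the
  within estimator of panel data, with windows as units).
\<close>

definition within_ols ::
  "nat \<Rightarrow> nat \<Rightarrow> (nat \<Rightarrow> real ^ 'p) \<Rightarrow> (nat \<Rightarrow> real) \<Rightarrow> real ^ 'p" where
  "within_ols n n0 x z = cramer_solution (within_scatter n n0 x) (within_cross n n0 x z)"

lemma within_ols_cong:
  assumes "\<And>i. i \<in> {1..n} \<Longrightarrow> x i = x' i" "\<And>i. i \<in> {1..n} \<Longrightarrow> z i = z' i"
  shows "within_ols n n0 x z = within_ols n n0 x' z'"
  unfolding within_ols_def
  using within_cross_cong[of n x x' z z' n0] within_scatter_cong[of n x x' n0] assms by simp

lemma within_ols_uminus: "within_ols n n0 x (\<lambda>i. - z i) = - within_ols n n0 x z"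
  by (simp add: within_ols_def within_cross_uminus cramer_solution_uminus)

lemma borel_measurable_within_ols:
  fixes x :: "'a \<Rightarrow> nat \<Rightarrow> real ^ 'p"
  assumes x: "\<And>i. i \<in> {1..n} \<Longrightarrow> (\<lambda>w. x w i) \<in> borel_measurable M"
    and z: "\<And>i. i \<in> {1..n} \<Longrightarrow> (\<lambda>w. z w i) \<in> borel_measurable M"
  shows "(\<lambda>w. within_ols n n0 (x w) (z w)) \<in> borel_measurable M"
proof -
  have x': "(\<lambda>w. x w i) \<in> borel_measurable M" and z': "(\<lambda>w. z w i) \<in> borel_measurable M"
    if "j \<in> {1..n div n0}" "i \<in> window n0 j" for j i
    using x z window_subset[OF that(1)] that(2) by blast+
  have xc: "(\<lambda>w. window_centred n0 (x w) j i) \<in> borel_measurable M"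
    and zc: "(\<lambda>w. window_centred n0 (z w) j i) \<in> borel_measurable M"
    if "j \<in> {1..n div n0}" "i \<in> window n0 j" for j i
    unfolding window_centred_def using x' z' that
    by (intro borel_measurable_diff borel_measurable_scaleR borel_measurable_sum; simp)+
  have "(\<lambda>w. within_scatter n n0 (x w) $ r $ s) \<in> borel_measurable M" for r s
    unfolding within_scatter_def using x' xc
    by (auto simp: borel_measurable_vec_iff intro!: borel_measurable_sum borel_measurable_times)
  moreover have "(\<lambda>w. within_cross n n0 (x w) (z w)) \<in> borel_measurable M"
    unfolding within_cross_def using x' zc
    by (intro borel_measurable_sum borel_measurable_scaleR) auto
  ultimately show ?thesis
    unfolding within_ols_def by (rule borel_measurable_cramer_solution)
qed

text \<open>
  In the model, \<open>u(y) = S *v \<beta> + u(e)\<close>, and at the estimator \<open>u(y) = S *v bhat\<close>. Subtracting shows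
  that \<open>bhat - \<beta>\<close> solves the normal equations with the model errors as responses.
\<close>

lemma EM_estimator_error:
  fixes x :: "nat \<Rightarrow> real ^ 'p"
  assumes "0 < n0" "n0 dvd n" "EM_identified n n0 x y" "EM_estimator n n0 x y bhat"
    and y: "\<And>j i. j \<in> {1..n div n0} \<Longrightarrow> i \<in> window n0 j \<Longrightarrow> y i = x i \<bullet> \<beta> + a j + e i"
  shows "bhat - \<beta> = within_ols n n0 x e"
proof -
  have 1: "within_cross n n0 x y = within_scatter n n0 x *v bhat"
    using EM_estimator_within_cross[OF assms(1,2,4)]
    by (simp add: within_cross_diff within_scatter_vector_mult)
  have "within_cross n n0 x (\<lambda>i. y i - x i \<bullet> \<beta> - e i) = 0"
    by (rule within_cross_window_constant[where a = a]) (use y assms(1) in auto)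
  then have 2: "within_cross n n0 x e = within_cross n n0 x y - within_scatter n n0 x *v \<beta>"
    by (simp add: within_cross_diff within_scatter_vector_mult)
  have "within_scatter n n0 x *v (bhat - \<beta>) = within_cross n n0 x e"
    using 1 2 by (simp add: matrix_vector_mult_diff_distrib)
  from cramer_solution_unique[OF EM_identified_imp_det_nonzero[OF assms(1,3)] this]
  show ?thesis unfolding within_ols_def .
qed

section \<open>Symmetry of the joint law\<close>

text \<open>
  Independence of the first and third sigma-algebra is the product formula on rectangles, which
  determine the law of the pair.
\<close>

lemma (in prob_space) distr_Pair_eq_of_mutually_indep3:
  fixes X :: "'a \<Rightarrow> 'b::second_countable_topology" and Z :: "'a \<Rightarrow> 'd::second_countable_topology"
  assumes "mutually_indep3 X Y Z"
  shows "distr M borel (\<lambda>\<omega>. (X \<omega>, Z \<omega>)) = distr M borel X \<Otimes>\<^sub>M distr M borel Z"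
proof (rule pair_measure_eqI[symmetric])
  from assms have X[measurable]: "random_variable borel X" and Z[measurable]: "random_variable borel Z"
    by (auto simp: mutually_indep3_def)
  interpret DX: prob_space "distr M borel X" by (rule prob_space_distr) fact
  interpret DZ: prob_space "distr M borel Z" by (rule prob_space_distr) fact
  show "sigma_finite_measure (distr M borel X)" "sigma_finite_measure (distr M borel Z)"
    by unfold_locales
  show "sets (distr M borel X \<Otimes>\<^sub>M distr M borel Z) = sets (distr M borel (\<lambda>\<omega>. (X \<omega>, Z \<omega>)))"
    by (simp add: borel_prod[symmetric] cong: sets_pair_measure_cong)
  fix A B assume "A \<in> sets (distr M borel X)" "B \<in> sets (distr M borel Z)"
  then have A[measurable]: "A \<in> sets borel" and B[measurable]: "B \<in> sets borel" by auto
  let ?F = "\<lambda>r. [{X -` A \<inter> space M | A. A \<in> sets borel},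
                      {Y -` A \<inter> space M | A. A \<in> sets borel},
                      {Z -` A \<inter> space M | A. A \<in> sets borel}] ! r"
  let ?E = "\<lambda>r::nat. if r = 0 then X -` A \<inter> space M else Z -` B \<inter> space M"
  have ind: "indep_sets ?F {0, 1, 2 :: nat}" using assms by (simp add: mutually_indep3_def)
  have "prob (\<Inter>r\<in>{0, 2}. ?E r) = (\<Prod>r\<in>{0, 2}. prob (?E r))"
    by (rule indep_setsD[OF ind]) (use A B in auto)
  then have prob: "prob ((X -` A \<inter> space M) \<inter> (Z -` B \<inter> space M))
      = prob (X -` A \<inter> space M) * prob (Z -` B \<inter> space M)" by (simp add: Int_commute)
  have AB: "A \<times> B \<in> sets (borel :: ('b \<times> 'd) measure)"
    unfolding borel_prod[symmetric] by measurable
  have "emeasure (distr M borel (\<lambda>\<omega>. (X \<omega>, Z \<omega>))) (A \<times> B)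
      = emeasure M ((\<lambda>\<omega>. (X \<omega>, Z \<omega>)) -` (A \<times> B) \<inter> space M)"
    by (rule emeasure_distr[OF _ AB]) measurable
  also have "(\<lambda>\<omega>. (X \<omega>, Z \<omega>)) -` (A \<times> B) \<inter> space M = (X -` A \<inter> space M) \<inter> (Z -` B \<inter> space M)"
    by auto
  finally show "emeasure (distr M borel X) A * emeasure (distr M borel Z) B
      = emeasure (distr M borel (\<lambda>\<omega>. (X \<omega>, Z \<omega>))) (A \<times> B)"
    by (simp add: emeasure_distr emeasure_eq_measure prob ennreal_mult)
qed

lemma (in prob_space) centred_normal_distr_uminus:
  assumes "distributed M lborel Z (\<lambda>t. ennreal (normal_density 0 s t))" "0 < s"
  shows "distr M borel (\<lambda>\<omega>. - Z \<omega>) = distr M borel Z"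
proof -
  have "distributed M lborel (\<lambda>\<omega>. 0 + (- 1) * Z \<omega>)
      (\<lambda>t. ennreal (normal_density (0 + (- 1) * 0) (\<bar>- 1\<bar> * s) t))"
    by (rule normal_density_affine[OF assms]) simp
  then have "distributed M lborel (\<lambda>\<omega>. - Z \<omega>) (\<lambda>t. ennreal (normal_density 0 s t))" by simp
  then have "distr M lborel (\<lambda>\<omega>. - Z \<omega>) = distr M lborel Z"
    using assms(1) by (simp add: distributed_distr_eq_density)
  moreover have "distr M borel f = distr M lborel f" for f :: "'a \<Rightarrow> real"
    by (rule distr_cong) auto
  ultimately show ?thesis by simp
qed

lemma borel_measurable_Pair_uminus:
  "(\<lambda>p. (fst p, - snd p)) \<in> borel_measurable
     (borel :: ('b::second_countable_topology \<times> 'd::{second_countable_topology, real_normed_vector}) measure)"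
  by (intro borel_measurable_continuous_onI continuous_intros)

lemma (in prob_space) distr_Pair_uminus:
  fixes X :: "'a \<Rightarrow> 'b::second_countable_topology"
    and Z :: "'a \<Rightarrow> 'd::{second_countable_topology, real_normed_vector}"
  assumes "mutually_indep3 X Y Z" "distr M borel (\<lambda>\<omega>. - Z \<omega>) = distr M borel Z"
  shows "distr M borel (\<lambda>\<omega>. (X \<omega>, - Z \<omega>)) = distr M borel (\<lambda>\<omega>. (X \<omega>, Z \<omega>))"
proof -
  let ?f = "\<lambda>p::'b \<times> 'd. (fst p, - snd p)"
  from assms have X[measurable]: "random_variable borel X" and Z[measurable]: "random_variable borel Z"
    by (auto simp: mutually_indep3_def)
  interpret DZ: prob_space "distr M borel Z" by (rule prob_space_distr) fact
  have sf: "sigma_finite_measure (distr (distr M borel Z) borel uminus)"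
    by (intro prob_space_imp_sigma_finite DZ.prob_space_distr) simp
  have neg: "distr (distr M borel Z) borel uminus = distr M borel Z"
    using assms(2) by (subst distr_distr) (auto simp: comp_def)
  have "distr M borel (\<lambda>\<omega>. (X \<omega>, - Z \<omega>)) = distr (distr M borel (\<lambda>\<omega>. (X \<omega>, Z \<omega>))) borel ?f"
    by (subst distr_distr) (auto simp: comp_def borel_measurable_Pair_uminus)
  also have "\<dots> = distr (distr M borel X \<Otimes>\<^sub>M distr M borel Z) borel ?f"
    by (simp add: distr_Pair_eq_of_mutually_indep3[OF assms(1)])
  also have "\<dots> = distr (distr M borel X \<Otimes>\<^sub>M distr M borel Z) (borel \<Otimes>\<^sub>M borel) (\<lambda>(a :: 'b, b :: 'd). (a, - b))"
    unfolding borel_prod by (simp add: case_prod_beta')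
  also have "\<dots> = distr (distr M borel X) borel (\<lambda>a. a) \<Otimes>\<^sub>M distr (distr M borel Z) borel uminus"
    using sf by (intro pair_measure_distr[symmetric]) auto
  also have "\<dots> = distr M borel X \<Otimes>\<^sub>M distr M borel Z"
    unfolding neg by (simp add: distr_id2)
  also have "\<dots> = distr M borel (\<lambda>\<omega>. (X \<omega>, Z \<omega>))"
    by (simp add: distr_Pair_eq_of_mutually_indep3[OF assms(1)])
  finally show ?thesis .
qed

text \<open>
  The joint law of independent variables is the product of the marginals, so invariance of every
  marginal under the change of sign passes to the joint law, and substitution of variables gives an
  expectation equal to its own negative. A non-integrable \<open>G\<close> has expectation 0 by convention.
\<close>

lemma (in prob_space) expectation_odd_eq_0:
  fixes X :: "'i \<Rightarrow> 'a \<Rightarrow> 'b::second_countable_topology"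
    and Z :: "'i \<Rightarrow> 'a \<Rightarrow> 'd::{second_countable_topology, real_normed_vector}"
    and G :: "('i \<Rightarrow> 'b \<times> 'd) \<Rightarrow> 'v::{banach, second_countable_topology}"
  assumes I: "I \<noteq> {}"
    and indep: "indep_vars (\<lambda>_. borel) (\<lambda>i \<omega>. (X i \<omega>, Z i \<omega>)) I"
    and sym: "\<And>i. i \<in> I \<Longrightarrow>
      distr M borel (\<lambda>\<omega>. (X i \<omega>, - Z i \<omega>)) = distr M borel (\<lambda>\<omega>. (X i \<omega>, Z i \<omega>))"
    and G[measurable]: "G \<in> borel_measurable (Pi\<^sub>M I (\<lambda>_. borel))"
    and odd: "\<And>w. G (\<lambda>i\<in>I. (fst (w i), - snd (w i))) = - G (\<lambda>i\<in>I. w i)"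
  shows "expectation (\<lambda>\<omega>. G (\<lambda>i\<in>I. (X i \<omega>, Z i \<omega>))) = 0"
proof -
  let ?W = "\<lambda>\<omega>. \<lambda>i\<in>I. (X i \<omega>, Z i \<omega>)" and ?W' = "\<lambda>\<omega>. \<lambda>i\<in>I. (X i \<omega>, - Z i \<omega>)"
  let ?P = "Pi\<^sub>M I (\<lambda>_. borel :: ('b \<times> 'd) measure)"
  have indep': "indep_vars (\<lambda>_. borel) (\<lambda>i \<omega>. (X i \<omega>, - Z i \<omega>)) I"
    using indep_vars_compose2[OF indep, of "\<lambda>_ p. (fst p, - snd p)" "\<lambda>_. borel"]
    by (simp add: borel_measurable_Pair_uminus)
  have rv: "random_variable borel (\<lambda>\<omega>. (X i \<omega>, Z i \<omega>))" if "i \<in> I" for i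
    using indep that by (auto simp: indep_vars_def)
  have rv': "random_variable borel (\<lambda>\<omega>. (X i \<omega>, - Z i \<omega>))" if "i \<in> I" for i
    using indep' that by (auto simp: indep_vars_def)
  have W: "?W \<in> measurable M ?P" by (intro measurable_restrict rv)
  have W': "?W' \<in> measurable M ?P" by (intro measurable_restrict rv')
  have "distr M ?P ?W = (\<Pi>\<^sub>M i\<in>I. distr M borel (\<lambda>\<omega>. (X i \<omega>, Z i \<omega>)))"
    using indep_vars_iff_distr_eq_PiM'[OF I rv] indep by simp
  also have "\<dots> = (\<Pi>\<^sub>M i\<in>I. distr M borel (\<lambda>\<omega>. (X i \<omega>, - Z i \<omega>)))"
    by (intro PiM_cong refl) (simp add: sym)
  also have "\<dots> = distr M ?P ?W'"
    using indep_vars_iff_distr_eq_PiM'[OF I rv'] indep' by simp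
  finally have law: "distr M ?P ?W = distr M ?P ?W'" .
  have "expectation (\<lambda>\<omega>. G (?W \<omega>)) = integral\<^sup>L (distr M ?P ?W) G"
    by (rule integral_distr[symmetric, OF W G])
  also have "\<dots> = expectation (\<lambda>\<omega>. G (?W' \<omega>))"
    unfolding law by (rule integral_distr[OF W' G])
  also have "\<dots> = expectation (\<lambda>\<omega>. - G (?W \<omega>))"
  proof (rule Bochner_Integration.integral_cong[OF refl])
    fix \<omega> show "G (?W' \<omega>) = - G (?W \<omega>)" using odd[of "\<lambda>i. (X i \<omega>, Z i \<omega>)"] by simp
  qed
  also have "\<dots> = - expectation (\<lambda>\<omega>. G (?W \<omega>))" by simp
  finally have "2 *\<^sub>R expectation (\<lambda>\<omega>. G (?W \<omega>)) = 0" by (simp add: scaleR_2 eq_neg_iff_add_eq_0)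
  then show ?thesis by simp
qed

section \<open>Windows and samples\<close>

lemma sample_indices_cover:
  "i \<in> {1..(\<Sum>j = 1..k. ns j)} \<Longrightarrow> \<exists>j \<in> {1..k}. i \<in> sample_indices ns j"
proof (induction k)
  case (Suc k)
  show ?case
  proof (cases "i \<le> (\<Sum>j = 1..k. ns j)")
    case True
    then show ?thesis using Suc by fastforce
  next
    case False
    then have "i \<in> sample_indices ns (Suc k)"
      using Suc.prems by (auto simp: sample_indices_def atLeastLessThanSuc_atLeastAtMost)
    then show ?thesis by auto
  qed
qed simp

text \<open>
  All boundaries between samples are multiples of \<open>n0\<close>, so the sample that contains the first index
  of a window ends no earlier than the window does.
\<close>

lemma window_subset_sample:
  assumes pos: "0 < n0" and dvd: "\<And>j. j \<in> {1..k} \<Longrightarrow> n0 dvd ns j"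
    and w: "w \<in> {1..(\<Sum>j = 1..k. ns j) div n0}"
  shows "\<exists>l \<in> {1..k}. window n0 w \<subseteq> sample_indices ns l"
proof -
  obtain m where m: "w = Suc m" using w by (cases w) auto
  have first: "m * n0 + 1 \<in> window n0 w" using pos by (simp add: window_def m)
  then have "m * n0 + 1 \<in> {1..(\<Sum>j = 1..k. ns j)}" using window_subset[OF w] by blast
  then obtain l where l: "l \<in> {1..k}" "m * n0 + 1 \<in> sample_indices ns l"
    using sample_indices_cover by blast
  have "n0 dvd (\<Sum>j = 1..l. ns j)" using dvd l(1) by (intro dvd_sum) auto
  then obtain q where q: "(\<Sum>j = 1..l. ns j) = q * n0" by (auto simp: dvd_def mult.commute)
  have "m * n0 < q * n0" 
    using l(2) unfolding sample_indices_def q[symmetric] atLeastAtMost_iff by linarith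
  then have "Suc m * n0 \<le> q * n0" by (intro mult_right_mono) auto
  then have "window n0 w \<subseteq> sample_indices ns l"
    using l(2) q by (auto simp: window_def sample_indices_def m)
  then show ?thesis using l(1) by blast
qed

theorem theorem1:
  fixes M :: "'a measure"
    and k n n0 :: nat and ns :: "nat \<Rightarrow> nat"
    and \<beta> :: "real ^ 'p"
    and x :: "nat \<Rightarrow> 'a \<Rightarrow> real ^ 'p" and y \<nu> \<epsilon> :: "nat \<Rightarrow> 'a \<Rightarrow> real"
    and F :: "(real ^ 'p) measure"
    and c \<sigma> :: "nat \<Rightarrow> real" and \<mu>_lo \<mu>_hi \<sigma>_lo \<sigma>_hi :: real
    and \<beta>_EM :: "'a \<Rightarrow> real ^ 'p"
  assumes model: "k_sample_model M k ns n \<beta> x y \<nu> \<epsilon> F c \<sigma> \<mu>_lo \<mu>_hi \<sigma>_lo \<sigma>_hi"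
    and window_pos: "0 < n0"
    and window_small: "n0 < Min (ns ` {1..k})"
    and window_dvd: "\<And>j. j \<in> {1..k} \<Longrightarrow> n0 dvd ns j"
    and indep: "\<And>i. i \<in> {1..n} \<Longrightarrow> prob_space.mutually_indep3 M (x i) (\<nu> i) (\<epsilon> i)"
    and identified: "AE \<omega> in M. EM_identified n n0 (\<lambda>i. x i \<omega>) (\<lambda>i. y i \<omega>)"
    and estimator: "AE \<omega> in M. EM_estimator n n0 (\<lambda>i. x i \<omega>) (\<lambda>i. y i \<omega>) (\<beta>_EM \<omega>)"
    and expectation_exists: "integrable M \<beta>_EM"
  shows "prob_space.expectation M \<beta>_EM = \<beta>"
proof -
  interpret k_sample_model M k ns n \<beta> x y \<nu> \<epsilon> F c \<sigma> \<mu>_lo \<mu>_hi \<sigma>_lo \<sigma>_hi by (fact model)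
  have n_dvd: "n0 dvd n" unfolding n_eq using window_dvd by (intro dvd_sum) auto
  have n_pos: "{1..n} \<noteq> {}"
  proof -
    have "Min (ns ` {1..k}) \<le> ns 1" using k_pos by (intro Min_le) auto
    also have "\<dots> \<le> n" unfolding n_eq using k_pos by (intro member_le_sum) auto
    finally show ?thesis using window_small by simp
  qed
  have "\<forall>i \<in> {1..n}. \<exists>j. j \<in> {1..k} \<and> i \<in> sample_indices ns j"
    using sample_indices_cover[of _ ns k] unfolding n_eq by blast
  from bchoice[OF this] obtain s where s: "s i \<in> {1..k}" "i \<in> sample_indices ns (s i)" if "i \<in> {1..n}" for i
    by blast
  have "\<forall>w \<in> {1..n div n0}. \<exists>j. j \<in> {1..k} \<and> window n0 w \<subseteq> sample_indices ns j"
    using window_subset_sample[OF window_pos, of k ns] window_dvd unfolding n_eq by blast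
  from bchoice[OF this] obtain l where l: "l w \<in> {1..k}" "window n0 w \<subseteq> sample_indices ns (l w)"
    if "w \<in> {1..n div n0}" for w by blast
  have intercept: "AE \<omega> in M. \<nu> i \<omega> = c j" if "i \<in> {1..n}" "j \<in> {1..k}" "i \<in> sample_indices ns j" for i j
  proof -
    have "AE t in distr M borel (\<nu> i). t = c j"
      unfolding \<nu>_distr[OF that(2,3)] by (subst AE_return) auto
    then show ?thesis by (rule AE_distrD[OF \<nu>_measurable[OF that(1)]])
  qed
  \<comment> \<open>A version of the error that is a function of the pair \<open>(x i, y i)\<close>, so that it inherits the
      independence of the pairs across \<open>i\<close>; it is almost surely equal to \<open>\<epsilon> i\<close>.\<close>
  define e where "e i \<omega> = y i \<omega> - x i \<omega> \<bullet> \<beta> - c (s i)" for i \<omega>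
  have e_eq: "AE \<omega> in M. e i \<omega> = \<epsilon> i \<omega>" if i: "i \<in> {1..n}" for i
    using intercept[OF i s[OF i]] AE_space
    by eventually_elim (simp add: e_def model[OF i])
  have fst_borel [measurable]: "fst \<in> borel_measurable (borel :: ((real ^ 'p) \<times> real) measure)"
    and snd_borel [measurable]: "snd \<in> borel_measurable (borel :: ((real ^ 'p) \<times> real) measure)"
    by (auto intro!: borel_measurable_continuous_onI continuous_on_fst continuous_on_snd continuous_on_id)
  have y_measurable: "random_variable borel (y i)" if "i \<in> {1..n}" for i
  proof -
    have "random_variable borel (\<lambda>\<omega>. (x i \<omega>, y i \<omega>))"
      using pairs_indep that by (auto simp: indep_vars_def)
    from measurable_compose[OF this snd_borel] show ?thesis by simp
  qed
  have e_measurable: "random_variable borel (e i)" if "i \<in> {1..n}" for i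
    unfolding e_def using x_measurable[OF that] y_measurable[OF that]
    by (intro borel_measurable_diff borel_measurable_inner borel_measurable_const)
  have \<epsilon>_measurable: "random_variable borel (\<epsilon> i)" if "i \<in> {1..n}" for i
    using indep[OF that] by (simp add: mutually_indep3_def)
  have e_indep: "indep_vars (\<lambda>_. borel) (\<lambda>i \<omega>. (x i \<omega>, e i \<omega>)) {1..n}"
  proof -
    have "indep_vars (\<lambda>_. borel)
        (\<lambda>i \<omega>. (\<lambda>p. (fst p, snd p - fst p \<bullet> \<beta> - c (s i))) (x i \<omega>, y i \<omega>)) {1..n}"
      by (rule indep_vars_compose2[OF pairs_indep]) measurable
    then show ?thesis by (simp add: e_def)
  qed
  have e_sym: "distr M borel (\<lambda>\<omega>. (x i \<omega>, - e i \<omega>)) = distr M borel (\<lambda>\<omega>. (x i \<omega>, e i \<omega>))"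
    if i: "i \<in> {1..n}" for i
  proof -
    note [measurable] = x_measurable[OF i] e_measurable[OF i] \<epsilon>_measurable[OF i]
    have "0 < \<sigma> (s i)" using \<sigma>_bounds[OF s(1)[OF i]] \<sigma>_lo_pos by simp
    then have sym: "distr M borel (\<lambda>\<omega>. - \<epsilon> i \<omega>) = distr M borel (\<epsilon> i)"
      using \<epsilon>_distr[OF s[OF i]] by (intro centred_normal_distr_uminus)
    have "distr M borel (\<lambda>\<omega>. (x i \<omega>, - e i \<omega>)) = distr M borel (\<lambda>\<omega>. (x i \<omega>, - \<epsilon> i \<omega>))"
      using e_eq[OF i] by (intro distr_cong_AE) auto
    also have "\<dots> = distr M borel (\<lambda>\<omega>. (x i \<omega>, \<epsilon> i \<omega>))"
      by (rule distr_Pair_uminus[OF indep[OF i] sym])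
    also have "\<dots> = distr M borel (\<lambda>\<omega>. (x i \<omega>, e i \<omega>))"
      using e_eq[OF i] by (intro distr_cong_AE) auto
    finally show ?thesis .
  qed
  \<comment> \<open>The estimation error as one function on the product space of all pairs.\<close>
  define G where "G w = within_ols n n0 (\<lambda>i. fst (w i)) (\<lambda>i. snd (w i))"
    for w :: "nat \<Rightarrow> (real ^ 'p) \<times> real"
  let ?P = "Pi\<^sub>M {1..n} (\<lambda>_. borel :: ((real ^ 'p) \<times> real) measure)"
  have G_measurable: "G \<in> borel_measurable ?P"
    unfolding G_def
  proof (rule borel_measurable_within_ols)
    fix i assume "i \<in> {1..n}"
    then have [measurable]: "(\<lambda>w. w i) \<in> measurable ?P borel"
      by (rule measurable_component_singleton)
    show "(\<lambda>w. fst (w i)) \<in> borel_measurable ?P" "(\<lambda>w. snd (w i)) \<in> borel_measurable ?P"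
      by measurable
  qed
  have G_odd: "G (\<lambda>i\<in>{1..n}. (fst (w i), - snd (w i))) = - G (\<lambda>i\<in>{1..n}. w i)" for w
    unfolding G_def within_ols_uminus[symmetric] by (rule within_ols_cong) auto
  have "AE \<omega> in M. \<forall>w \<in> {1..n div n0}. \<forall>i \<in> window n0 w. \<nu> i \<omega> = c (l w)"
  proof (intro AE_finite_allI)
    fix w i assume w: "w \<in> {1..n div n0}" and i: "i \<in> window n0 w"
    show "AE \<omega> in M. \<nu> i \<omega> = c (l w)"
      using window_subset[OF w] l[OF w] i by (intro intercept) auto
  qed (auto simp: window_def)
  moreover have "AE \<omega> in M. \<forall>i \<in> {1..n}. e i \<omega> = \<epsilon> i \<omega>"
    using e_eq by (intro AE_finite_allI) auto
  ultimately have error: "AE \<omega> in M. \<beta>_EM \<omega> - \<beta> = G (\<lambda>i\<in>{1..n}. (x i \<omega>, e i \<omega>))"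
    using identified estimator AE_space
  proof eventually_elim
    case (elim \<omega>)
    \<comment> \<open>Here the intercepts are indexed by windows (\<open>c (l w)\<close>), while \<open>e\<close> uses \<open>c (s i)\<close>. Working with
        \<open>\<epsilon>\<close> first avoids comparing the two choices of a sample.\<close>
    have "\<beta>_EM \<omega> - \<beta> = within_ols n n0 (\<lambda>i. x i \<omega>) (\<lambda>i. \<epsilon> i \<omega>)"
    proof (rule EM_estimator_error[OF window_pos n_dvd elim(3,4)])
      fix w i assume w: "w \<in> {1..n div n0}" and i: "i \<in> window n0 w"
      then have "i \<in> {1..n}" using window_subset by blast
      then show "y i \<omega> = x i \<omega> \<bullet> \<beta> + c (l w) + \<epsilon> i \<omega>"
        using model elim(1,5) w i by simp
    qed
    also have "\<dots> = G (\<lambda>i\<in>{1..n}. (x i \<omega>, e i \<omega>))"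
      unfolding G_def by (rule within_ols_cong) (use elim(2) in auto)
    finally show ?case .
  qed
  have W: "(\<lambda>\<omega>. \<lambda>i\<in>{1..n}. (x i \<omega>, e i \<omega>)) \<in> measurable M ?P"
  proof (rule measurable_restrict)
    fix i assume i: "i \<in> {1..n}"
    show "random_variable borel (\<lambda>\<omega>. (x i \<omega>, e i \<omega>))"
      by (intro borel_measurable_Pair x_measurable e_measurable i)
  qed
  have "expectation \<beta>_EM - \<beta> = expectation (\<lambda>\<omega>. \<beta>_EM \<omega> - \<beta>)"
    using expectation_exists by (simp add: prob_space)
  also have "\<dots> = expectation (\<lambda>\<omega>. G (\<lambda>i\<in>{1..n}. (x i \<omega>, e i \<omega>)))"
    using error expectation_exists measurable_compose[OF W G_measurable]
    by (intro integral_cong_AE) auto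
  also have "\<dots> = 0"
    by (rule expectation_odd_eq_0[OF n_pos e_indep e_sym G_measurable G_odd])
  finally show ?thesis by simp
qed

end
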